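(* We have \[ h(4,m) \geq m^2 + 9m - 3 \text{ for } m \geq 3,\qquad h(8,m) \geq m^2 + 19m - 11 \text{ for } m \geq 4,\qquad h(16,m) \geq m^2 + 33m - 17 \text{ for } m \geq 10. \]
   Context: For a real matrix $A \in \mathbb{R}^{m\times n}$ and $1 \le k \le \min\{m,n\}$, let $\Delta_k(A)$ denote the maximum of $|\det(B)|$ over all $k\times k$ submatrices $B$ of $A$. The generalized Heller constant $h(\Delta,m)$ (for $\Delta, m \in \mathbb{Z}_{>0}$) is the maximum $n \in \mathbb{Z}_{>0}$ such that there exists an integer matrix $A \in \mathbb{Z}^{m\times n}$ with pairwise distinct columns and $\Delta_m(A) = \Delta$. *)

theory Defs
  imports "Jordan_Normal_Form.Determinant" "Jordan_Normal_Form.DL_Submatrix"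
begin

definition Delta_minor :: "nat \<Rightarrow> int mat \<Rightarrow> int" where
  "Delta_minor k A = Max {\<bar>det (submatrix A I J)\<bar> | I J.
      I \<subseteq> {..<dim_row A} \<and> J \<subseteq> {..<dim_col A} \<and> card I = k \<and> card J = k}"

definition heller :: "nat \<Rightarrow> nat \<Rightarrow> nat" where
  "heller D m = Max {n. n > 0 \<and> (\<exists>A \<in> carrier_mat m n. distinct (cols A) \<and> Delta_minor m A = int D)}"

end

theory Submission
  imports Defs
begin

text \<open>
  Let \<open>P\<close> consist of \<open>0\<close> and the roots of type \<open>A\<^sub>d\<close>, that is, \<open>P = E - E\<close> for the vertex set
  \<open>E = {0, e\<^sub>1, \<dots>, e\<^sub>d}\<close> of a simplex, and let \<open>Q\<close> be \<open>P\<close> together with the remaining unit vectors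
  \<open>e\<^sub>j\<close>, \<open>d < j \<le> m\<close>. The columns of the matrix are the elements of \<open>Q - Q\<close>. Pivoting on the rows
  \<open>j > d\<close> reduces every maximal minor to a minor of order \<open>d\<close> with columns in \<open>P - P\<close>, and the
  roots being unimodular, multilinearity bounds it by \<open>2\<^sup>d\<close>; the columns \<open>2e\<^sub>i\<close> (\<open>i \<le> d\<close>) and \<open>e\<^sub>j\<close>
  (\<open>j > d\<close>) attain the bound. The three estimates are the cases \<open>d = 2, 3, 4\<close>, where \<open>P - P\<close> has
  19, 55 and 131 elements.
\<close>

section \<open>Determinants given by columns\<close>

text \<open>Vectors are functions on all of \<open>nat\<close>, so every dimension shares one type
  during inductions, and replacing a column is a function update. The first argument of
  \<open>c\<close> is the column index.\<close>

definition coldet :: "nat \<Rightarrow> (nat \<Rightarrow> nat \<Rightarrow> int) \<Rightarrow> int" where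
  "coldet n c = det (mat n n (\<lambda>(i, j). c j i))"

lemma coldet_cong:
  assumes "\<And>j i. j < n \<Longrightarrow> i < n \<Longrightarrow> c j i = c' j i"
  shows "coldet n c = coldet n c'"
  unfolding coldet_def by (rule arg_cong[of _ _ det], rule eq_matI) (use assms in auto)

lemma coldet_leibniz:
  "coldet n c = (\<Sum>p | p permutes {0..<n}. signof p * (\<Prod>j<n. c j (p j)))"
proof -
  have "p j < n" if "p permutes {0..<n}" "j < n" for p j
    using that permutes_in_image[of p "{0..<n}" j] by simp
  then show ?thesis
    unfolding coldet_def by (subst det_col[of _ n]) (auto intro!: sum.cong prod.cong)
qed

text \<open>The library rule permutes rows, so the matrix is transposed first; the absolute value
  then removes the sign of \<open>p\<close>.\<close>

lemma coldet_permute: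
  assumes p: "p permutes {0..<n}"
  shows "\<bar>coldet n (\<lambda>j. c (p j))\<bar> = \<bar>coldet n c\<bar>"
proof -
  have lt: "p j < n" if "j < n" for j
    using that permutes_in_image[OF p, of j] by simp
  let ?M = "mat n n (\<lambda>(i, j). c i j)"
  have tr: "coldet n c' = det (mat n n (\<lambda>(i, j). c' i j))" for c' :: "nat \<Rightarrow> nat \<Rightarrow> int"
  proof -
    have "mat n n (\<lambda>(i, j). c' j i) = transpose_mat (mat n n (\<lambda>(i, j). c' i j))"
      by (rule eq_matI) auto
    then show ?thesis unfolding coldet_def by (simp add: det_transpose[of _ n])
  qed
  have "mat n n (\<lambda>(i, j). c (p i) j) = mat n n (\<lambda>(i, j). ?M $$ (p i, j))"
    by (rule eq_matI) (auto simp: lt)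
  then have "coldet n (\<lambda>j. c (p j)) = signof p * coldet n c"
    unfolding tr using det_permute_rows[OF _ p, of ?M] by simp
  then show ?thesis by (simp add: abs_mult sign_def)
qed

text \<open>Each Leibniz product has exactly one factor from column \<open>k\<close>, hence is
  linear in that column.\<close>

lemma coldet_diff_column:
  assumes "k < n"
  shows "coldet n (c(k := \<lambda>i. a i - b i)) = coldet n (c(k := a)) - coldet n (c(k := b))"
proof -
  have *: "(\<Prod>j<n. (c(k := x)) j (p j)) = x (p k) * (\<Prod>j\<in>{..<n}-{k}. c j (p j))" for x p
  proof -
    have "(\<Prod>j<n. (c(k := x)) j (p j))
        = (c(k := x)) k (p k) * (\<Prod>j\<in>{..<n}-{k}. (c(k := x)) j (p j))"
      by (rule prod.remove) (use assms in auto)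
    also have "(\<Prod>j\<in>{..<n}-{k}. (c(k := x)) j (p j)) = (\<Prod>j\<in>{..<n}-{k}. c j (p j))"
      by (rule prod.cong) auto
    finally show ?thesis by simp
  qed
  show ?thesis
    unfolding coldet_leibniz * by (simp add: sum_subtractf[symmetric] algebra_simps)
qed

lemma coldet_zero_row:
  assumes "\<And>j. j \<le> n \<Longrightarrow> c j n = 0"
  shows "coldet (Suc n) c = 0"
  unfolding coldet_def using assms
  by (subst laplace_expansion_row[of _ "Suc n" n]) auto

lemma coldet_repeated_column:
  assumes "a < n" "b < n" "a \<noteq> b" "c a = c b"
  shows "coldet n c = 0"
  unfolding coldet_def using assms
  by (intro det_identical_columns[of _ n a b]) auto

lemma coldet_diagonal:
  assumes "\<And>i j. i < n \<Longrightarrow> j < n \<Longrightarrow> i \<noteq> j \<Longrightarrow> c j i = 0"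
  shows "coldet n c = (\<Prod>j<n. c j j)"
proof -
  have "coldet n c = prod_list (diag_mat (mat n n (\<lambda>(i, j). c j i)))"
    unfolding coldet_def using assms by (intro det_lower_triangular[of n]) auto
  also have "\<dots> = (\<Prod>j<n. c j j)"
    by (auto simp: prod_list_diag_prod atLeast0LessThan intro!: prod.cong)
  finally show ?thesis .
qed

text \<open>The pivot is a unit of the integers and so its own inverse. Subtracting multiples of the
  last column clears the rest of the last row, and expansion along that row leaves the smaller
  determinant up to sign.\<close>

lemma coldet_eliminate:
  assumes "c n n * c n n = 1"
  shows "\<bar>coldet (Suc n) c\<bar> = \<bar>coldet n (\<lambda>j i. c j i - c j n * c n n * c n i)\<bar>"
proof -
  let ?N = "Suc n"
  let ?A = "mat ?N ?N (\<lambda>(i, j). c j i)"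
  \<comment> \<open>Right multiplication by this unit lower triangular matrix performs all the
    column operations at once.\<close>
  let ?T = "mat ?N ?N (\<lambda>(i, j). if i = j then 1 else if i = n then - (c j n * c n n) else 0)"
  let ?c = "\<lambda>j i. if j = n then c n i else c j i - c j n * c n n * c n i"
  let ?B = "mat ?N ?N (\<lambda>(i, j). ?c j i)"
  have T: "det ?T = 1"
    by (subst det_lower_triangular[of ?N]) (auto simp: prod_list_diag_prod)
  have "?A * ?T = ?B"
  proof (rule eq_matI)
    fix i j assume "i < dim_row ?B" "j < dim_col ?B"
    then have i: "i < ?N" and j: "j < ?N" by auto
    have "(?A * ?T) $$ (i, j) = (\<Sum>k<?N. c k i * ?T $$ (k, j))"
      using i j by (auto simp: scalar_prod_def atLeast0LessThan intro!: sum.cong)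
    also have "\<dots> = (\<Sum>k<n. c k i * (if k = j then 1 else 0)) + c n i * ?T $$ (n, j)"
      using j by (auto intro!: sum.cong)
    also have "\<dots> = ?c j i"
      using j by (auto simp: if_distrib[of "\<lambda>x. _ * x"] cong: if_cong)
    finally show "(?A * ?T) $$ (i, j) = ?B $$ (i, j)" using i j by simp
  qed auto
  then have "det ?A = det ?B"
    using det_mult[of ?A ?N ?T] T by simp
  also have "\<dots> = (\<Sum>j<?N. ?B $$ (n, j) * cofactor ?B n j)"
    by (rule laplace_expansion_row) auto
  also have "\<dots> = (\<Sum>j<?N. if j = n then c n n * cofactor ?B n n else 0)"
    using assms by (intro sum.cong) (auto simp: algebra_simps)
  also have "\<dots> = c n n * det (mat_delete ?B n n)"
    by (simp add: cofactor_def)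
  also have "mat_delete ?B n n = mat n n (\<lambda>(i, j). c j i - c j n * c n n * c n i)"
    by (rule eq_matI) (auto simp: mat_delete_def)
  finally have "coldet ?N c = c n n * coldet n (\<lambda>j i. c j i - c j n * c n n * c n i)"
    unfolding coldet_def .
  moreover have "\<bar>c n n\<bar> = 1"
    using assms by (metis abs_zmult_eq_1 abs_1)
  ultimately show ?thesis by (simp add: abs_mult)
qed

text \<open>This is row \<open>r\<close> of \<open>?B * adj_mat ?B = det ?B * 1\<close> applied to
  \<open>a\<close>: the determinants with a replaced column are the entries of the adjugate times
  \<open>a\<close>.\<close>

lemma coldet_cramer:
  assumes r: "r < n"
  shows "(\<Sum>k<n. c k r * coldet n (c(k := a))) = coldet n c * a r"
proof -
  let ?B = "mat n n (\<lambda>(i, j). c j i)"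
  have rep: "coldet n (c(k := a)) = (\<Sum>s<n. a s * cofactor ?B s k)" if k: "k < n" for k
  proof -
    let ?C = "mat n n (\<lambda>(i, j). (c(k := a)) j i)"
    \<comment> \<open>The two matrices differ only in column \<open>k\<close>, which is deleted
      here.\<close>
    have "mat_delete ?C s k = mat_delete ?B s k" if "s < n" for s
      using that k by (intro eq_matI) (auto simp: mat_delete_def)
    then have "cofactor ?C s k = cofactor ?B s k" if "s < n" for s
      using that unfolding cofactor_def by simp
    then show ?thesis
      unfolding coldet_def using k
      by (subst laplace_expansion_column[of _ n k]) auto
  qed
  have adj: "(\<Sum>k<n. c k r * cofactor ?B s k) = (if r = s then det ?B else 0)" if s: "s < n" for s
  proof -
    have "(?B * adj_mat ?B) $$ (r, s) = (\<Sum>k<n. c k r * cofactor ?B s k)"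
      using r s by (auto simp: scalar_prod_def adj_mat_def atLeast0LessThan intro!: sum.cong)
    moreover have "(?B * adj_mat ?B) $$ (r, s) = (if r = s then det ?B else 0)"
      using r s by (subst adj_mat(2)[of _ n]) auto
    ultimately show ?thesis by simp
  qed
  have "(\<Sum>k<n. c k r * coldet n (c(k := a)))
      = (\<Sum>k<n. \<Sum>s<n. a s * (c k r * cofactor ?B s k))"
    by (intro sum.cong) (auto simp: rep sum_distrib_left algebra_simps)
  also have "\<dots> = (\<Sum>s<n. a s * (\<Sum>k<n. c k r * cofactor ?B s k))"
    by (subst sum.swap) (simp add: sum_distrib_left)
  also have "\<dots> = (\<Sum>s<n. if s = r then a s * det ?B else 0)"
    by (intro sum.cong) (auto simp: adj)
  also have "\<dots> = coldet n c * a r"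
    using r by (simp add: coldet_def)
  finally show ?thesis .
qed

section \<open>Difference sets and their minors\<close>

definition difference_set :: "(nat \<Rightarrow> int) set \<Rightarrow> (nat \<Rightarrow> int) set" where
  "difference_set Q = {\<lambda>i. x i - y i | x y. x \<in> Q \<and> y \<in> Q}"

definition unitf :: "nat \<Rightarrow> nat \<Rightarrow> int" where
  "unitf k = (\<lambda>i. of_bool (i = k))"

definition minors_le :: "nat \<Rightarrow> (nat \<Rightarrow> int) set \<Rightarrow> int \<Rightarrow> bool" where
  "minors_le n V B \<longleftrightarrow> (\<forall>c. (\<forall>j<n. c j \<in> V) \<longrightarrow> \<bar>coldet n c\<bar> \<le> B)"

lemma difference_setI: "x \<in> Q \<Longrightarrow> y \<in> Q \<Longrightarrow> (\<lambda>i. x i - y i) \<in> difference_set Q"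
  unfolding difference_set_def by blast

lemma difference_set_eq_image: "difference_set Q = (\<lambda>(x, y) i. x i - y i) ` (Q \<times> Q)"
  unfolding difference_set_def by auto

lemma finite_difference_set: "finite Q \<Longrightarrow> finite (difference_set Q)"
  by (simp add: difference_set_eq_image)

lemma difference_set_vanish:
  assumes "x \<in> difference_set Q" "\<And>q. q \<in> Q \<Longrightarrow> q n = 0"
  shows "x n = 0"
proof -
  obtain y z where yz: "y \<in> Q" "z \<in> Q" and x: "x = (\<lambda>i. y i - z i)"
    using assms(1) unfolding difference_set_def by blast
  then show ?thesis unfolding x using assms(2)[OF yz(1)] assms(2)[OF yz(2)] by simp
qed

text \<open>A column with a nonzero entry in the last row serves as pivot. Clearing that row replaces
  \<open>e - q\<close> by its difference with the pivot \<open>e - p\<close>, which is again a difference of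
  elements of \<open>Q\<close>.\<close>
lemma minors_le_insert_unit:
  assumes bd: "minors_le n (difference_set Q) B" and ne: "Q \<noteq> {}" and van: "\<And>q. q \<in> Q \<Longrightarrow> q n = 0"
  shows "minors_le (Suc n) (difference_set (insert (unitf n) Q)) B"
  unfolding minors_le_def
proof (intro allI impI)
  fix c assume c: "\<forall>j<Suc n. c j \<in> difference_set (insert (unitf n) Q)"
  have zero: "(\<lambda>i. 0) \<in> difference_set Q" using ne difference_setI by fastforce
  \<comment> \<open>Needed for the case where the last row vanishes and the determinant is
    0.\<close>
  have B: "0 \<le> B"
    using bd zero unfolding minors_le_def by (metis abs_ge_zero order_trans)
  have split: "x \<in> difference_set Q \<and> x n = 0
      \<or> (\<exists>q\<in>Q. \<exists>s\<in>{-1, 1}. x n = s \<and> x = (\<lambda>i. s * (unitf n i - q i)))"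
    if x: "x \<in> difference_set (insert (unitf n) Q)" for x
  proof -
    obtain y z where yz: "y \<in> insert (unitf n) Q" "z \<in> insert (unitf n) Q"
      and xe: "x = (\<lambda>i. y i - z i)" using x unfolding difference_set_def by blast
    consider "y \<in> Q" "z \<in> Q" | "y = unitf n" "z = unitf n"
      | "y = unitf n" "z \<in> Q" | "y \<in> Q" "z = unitf n" using yz by blast
    then show ?thesis
    proof cases
      case 1
      then show ?thesis using difference_setI[of y Q z] van[of y] van[of z] by (simp add: xe)
    next
      case 2
      then show ?thesis using zero by (simp add: xe)
    next
      case 3
      then have "x n = 1" "x = (\<lambda>i. 1 * (unitf n i - z i))"
        using van[of z] by (auto simp: xe unitf_def)
      then show ?thesis using 3 by blast
    next
      case 4
      then have "x n = -1" "x = (\<lambda>i. -1 * (unitf n i - y i))"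
        using van[of y] by (auto simp: xe unitf_def)
      then show ?thesis using 4 by blast
    qed
  qed
  show "\<bar>coldet (Suc n) c\<bar> \<le> B"
  proof (cases "\<forall>j\<le>n. c j n = 0")
    case True
    then show ?thesis using coldet_zero_row[of n c] B by simp
  next
    case False
    then obtain k where k: "k \<le> n" "c k n \<noteq> 0" by blast
    \<comment> \<open>Swapping columns \<open>k\<close> and \<open>n\<close> brings the pivot to the
      corner required by \<open>coldet_eliminate\<close>.\<close>
    let ?p = "transpose k n"
    have p: "?p permutes {0..<Suc n}" using k by (intro permutes_swap_id) auto
    define c' where "c' = (\<lambda>j. c (?p j))"
    have c': "c' j \<in> difference_set (insert (unitf n) Q)" if "j \<le> n" for j
    proof -
      have "?p j < Suc n" using that k by (auto simp: transpose_def)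
      then show ?thesis unfolding c'_def using c by blast
    qed
    have "c' n n \<noteq> 0" unfolding c'_def using k by simp
    then obtain p s where ps: "p \<in> Q" "s \<in> {-1, 1}" "c' n n = s"
      "c' n = (\<lambda>i. s * (unitf n i - p i))" using split[OF c'[of n]] by blast
    have ss: "s * s = 1" using ps by auto
    let ?d = "\<lambda>j i. c' j i - c' j n * c' n n * c' n i"
    have "?d j \<in> difference_set Q" if "j < n" for j
      using split[OF c'[OF less_imp_le[OF that]]]
    proof
      assume "c' j \<in> difference_set Q \<and> c' j n = 0"
      then show ?thesis by simp
    next
      assume "\<exists>q\<in>Q. \<exists>s\<in>{-1, 1}. c' j n = s \<and> c' j = (\<lambda>i. s * (unitf n i - q i))"
      then obtain q t where q: "q \<in> Q" "t \<in> {-1, 1}" "c' j n = t"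
        "c' j = (\<lambda>i. t * (unitf n i - q i))" by blast
      have "?d j i = t * (p i - q i)" for i
      proof -
        have "?d j i = t * (unitf n i - q i) - t * (s * s) * (unitf n i - p i)"
          unfolding q(3) ps(3) unfolding q(4) ps(4) by (simp add: algebra_simps)
        then show ?thesis unfolding ss by (simp add: algebra_simps)
      qed
      then have eq: "?d j = (\<lambda>i. t * (p i - q i))" by blast
      have mem: "(\<lambda>i. t * (p i - q i)) \<in> difference_set Q"
      proof (cases "t = 1")
        case True
        then show ?thesis using difference_setI[OF ps(1) q(1)] by simp
      next
        case False
        then show ?thesis using q(2) difference_setI[OF q(1) ps(1)] by simp
      qed
      show ?thesis by (rule ssubst[of _ _ "\<lambda>x. x \<in> difference_set Q", OF eq mem])
    qed
    then have "\<bar>coldet n ?d\<bar> \<le> B" by (rule bd[unfolded minors_le_def, rule_format])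
    moreover have "\<bar>coldet (Suc n) c\<bar> = \<bar>coldet (Suc n) c'\<bar>"
      unfolding c'_def using coldet_permute[OF p, of c] by simp
    moreover have "\<bar>coldet (Suc n) c'\<bar> = \<bar>coldet n ?d\<bar>"
      by (rule coldet_eliminate) (use ps(3) ss in simp)
    ultimately show ?thesis by simp
  qed
qed

lemma minors_le_add_units:
  assumes "minors_le d (difference_set Q) B" "Q \<noteq> {}" "\<And>q i. q \<in> Q \<Longrightarrow> d \<le> i \<Longrightarrow> q i = 0"
  shows "minors_le (d + k) (difference_set (Q \<union> unitf ` {d..<d + k})) B"
proof (induction k)
  case 0
  then show ?case using assms by simp
next
  case (Suc k)
  have "Q \<union> unitf ` {d..<d + Suc k} = insert (unitf (d + k)) (Q \<union> unitf ` {d..<d + k})"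
    by (auto simp: atLeastLessThanSuc)
  moreover have "q (d + k) = 0" if "q \<in> Q \<union> unitf ` {d..<d + k}" for q
    using that assms(3) by (auto simp: unitf_def)
  ultimately show ?case using minors_le_insert_unit[OF Suc.IH] assms(2) by simp
qed

text \<open>Expanding one difference column yields two determinants with a column from
  \<open>V\<close>, which doubles the bound. The induction is on the number \<open>k\<close> of
  leading columns taken from the difference set.\<close>

lemma minors_le_diffs:
  assumes "minors_le n V B"
  shows "minors_le n (difference_set V) (2 ^ n * B)"
proof -
  have "\<bar>coldet n c\<bar> \<le> 2 ^ k * B"
    if "k \<le> n" "\<forall>j<k. c j \<in> difference_set V" "\<forall>j<n. k \<le> j \<longrightarrow> c j \<in> V" for k c
    using that
  proof (induction k arbitrary: c)
    case 0
    then show ?case using assms unfolding minors_le_def by simp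
  next
    case (Suc k)
    obtain x y where xy: "x \<in> V" "y \<in> V" "c k = (\<lambda>i. x i - y i)"
      using Suc.prems(2) unfolding difference_set_def by blast
    have "\<bar>coldet n (c(k := z))\<bar> \<le> 2 ^ k * B" if "z \<in> V" for z
      by (rule Suc.IH) (use Suc.prems that in \<open>auto simp: less_Suc_eq Suc_le_eq\<close>)
    from this[OF xy(1)] this[OF xy(2)] show ?case
      using coldet_diff_column[of k n c x y] Suc.prems(1) fun_upd_idem[of c k, OF xy(3)]
      by simp
  qed
  then show ?thesis unfolding minors_le_def by simp
qed

section \<open>Counting differences when unit vectors are adjoined\<close>

text \<open>Coordinate \<open>n\<close> is 0 on the old differences, 1 on \<open>U\<close> and -1 on
  \<open>L\<close>, so these three sets are disjoint, and \<open>U\<close> and \<open>L\<close> each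
  have as many elements as \<open>Q\<close>.\<close>

lemma card_diffs_insert_unit:
  assumes fin: "finite Q" and ne: "Q \<noteq> {}" and van: "\<And>q. q \<in> Q \<Longrightarrow> q n = 0"
  shows "card (difference_set (insert (unitf n) Q)) = card (difference_set Q) + 2 * card Q"
proof -
  define U where "U = (\<lambda>q i. unitf n i - q i) ` Q"
  define L where "L = (\<lambda>q i. q i - unitf n i) ` Q"
  have zero: "(\<lambda>i. 0) \<in> difference_set Q" using ne difference_setI by fastforce
  have eq: "difference_set (insert (unitf n) Q) = difference_set Q \<union> (U \<union> L)"
    using zero unfolding difference_set_def U_def L_def by auto
  have v: "x \<in> difference_set Q \<Longrightarrow> x n = 0" "x \<in> U \<Longrightarrow> x n = 1" "x \<in> L \<Longrightarrow> x n = -1" for x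
    using van difference_set_vanish[OF _ van, of x] by (auto simp: unitf_def U_def L_def)
  have disj: "difference_set Q \<inter> (U \<union> L) = {}" "U \<inter> L = {}"
    by (auto dest!: v)
  have "inj_on (\<lambda>q i. unitf n i - q i) Q" "inj_on (\<lambda>q i. q i - unitf n i) Q"
    by (auto intro!: inj_onI simp: fun_eq_iff)
  then have "card U = card Q" "card L = card Q" unfolding U_def L_def by (auto intro: card_image)
  moreover have "finite U" "finite L" using fin by (auto simp: U_def L_def)
  ultimately show ?thesis
    unfolding eq using disj fin by (simp add: card_Un_disjoint finite_difference_set)
qed

text \<open>Step \<open>i\<close> contributes \<open>2 * (card Q + i)\<close>, in total
  \<open>2 * k * card Q + k * (k - 1)\<close>. The summand \<open>k\<close> on the left avoids
  subtraction on \<open>nat\<close>.\<close>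

lemma card_diffs_add_units:
  assumes "finite Q" "Q \<noteq> {}" "\<And>q i. q \<in> Q \<Longrightarrow> d \<le> i \<Longrightarrow> q i = 0"
  shows "card (difference_set (Q \<union> unitf ` {d..<d + k})) + k = card (difference_set Q) + 2 * k * card Q + k * k"
proof -
  let ?Q = "\<lambda>k. Q \<union> unitf ` {d..<d + k}"
  have ins: "?Q (Suc k) = insert (unitf (d + k)) (?Q k)" for k
    by (auto simp: atLeastLessThanSuc)
  have van: "q (d + k) = 0" if "q \<in> ?Q k" for q k
    using that assms(3) by (auto simp: unitf_def)
  have card: "card (?Q k) = card Q + k" for k
  proof (induction k)
    case (Suc k)
    have "unitf (d + k) \<notin> ?Q k" using van[of "unitf (d + k)" k] by (auto simp: unitf_def)
    then show ?case unfolding ins using Suc assms(1) by simp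
  qed simp
  show ?thesis
  proof (induction k)
    case (Suc k)
    have "card (difference_set (?Q (Suc k))) = card (difference_set (?Q k)) + 2 * card (?Q k)"
      unfolding ins by (rule card_diffs_insert_unit) (use assms van in auto)
    then show ?case using Suc card[of k] by (simp add: algebra_simps)
  qed simp
qed

section \<open>The simplex, its roots and their differences\<close>

definition simplex :: "nat \<Rightarrow> (nat \<Rightarrow> int) set" where
  "simplex d = insert (\<lambda>i. 0) (unitf ` {..<d})"

lemma simplex_eq: "simplex d = {\<lambda>i. 0} \<union> unitf ` {0..<0 + d}"
  unfolding simplex_def by (simp add: atLeast0LessThan)

lemma card_diffs_simplex: "card (difference_set (simplex d)) = d * d + d + 1"
proof -
  have "difference_set {\<lambda>i. 0} = {\<lambda>i. 0}" unfolding difference_set_def by auto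
  then show ?thesis
    unfolding simplex_eq using card_diffs_add_units[of "{\<lambda>i. 0}" 0 d] by simp
qed

text \<open>Unimodularity of the roots: starting from the empty determinant 1 in dimension 0, each
  adjoined unit vector preserves the bound.\<close>

lemma minors_le_roots: "minors_le d (difference_set (simplex d)) 1"
proof -
  have "minors_le 0 (difference_set {\<lambda>i. 0}) 1" unfolding minors_le_def coldet_def by simp
  from minors_le_add_units[OF this, of d] show ?thesis unfolding simplex_eq by simp
qed

text \<open>The linear functional with weights \<open>5 ^ i\<close> turns the count into one about integers. Writing
  \<open>(a - b) - (c - d)\<close> as \<open>(a + d) - (b + c)\<close> keeps the number of pairs to be evaluated small.\<close>
lemma card_diffs_roots_ge:
  fixes S :: "int set"
  assumes S: "S \<subseteq> (\<lambda>(a, b). a + b) ` (set (0 # map (\<lambda>i. 5 ^ i) [0..<d])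
    \<times> set (0 # map (\<lambda>i. 5 ^ i) [0..<d]))"
  shows "card ((\<lambda>(a, b). a - b) ` (S \<times> S)) \<le> card (difference_set (difference_set (simplex d)))"
proof -
  let ?D = "difference_set (difference_set (simplex d))"
  define f :: "(nat \<Rightarrow> int) \<Rightarrow> int" where "f = (\<lambda>x. \<Sum>i<d. x i * 5 ^ i)"
  have f: "f (\<lambda>i. x i - y i) = f x - f y" for x y
    unfolding f_def by (simp add: sum_subtractf algebra_simps)
  have "f (unitf k) = 5 ^ k" if "k < d" for k
    using that unfolding f_def unitf_def
    by (simp add: of_bool_def if_distrib[of "\<lambda>x. x * _"] cong: if_cong)
  then have W: "set (0 # map (\<lambda>i. 5 ^ i) [0..<d]) = f ` simplex d"
    unfolding simplex_def by (auto simp: f_def image_iff)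
  have "(\<lambda>(a, b). a - b) ` (S \<times> S) \<subseteq> f ` ?D"
  proof clarify
    fix s t assume "s \<in> S" "t \<in> S"
    then have "s \<in> (\<lambda>(a, b). a + b) ` (f ` simplex d \<times> f ` simplex d)"
      "t \<in> (\<lambda>(a, b). a + b) ` (f ` simplex d \<times> f ` simplex d)"
      using S unfolding W by (meson subsetD)+
    then obtain a b c e where v: "a \<in> simplex d" "b \<in> simplex d" "c \<in> simplex d" "e \<in> simplex d"
      and st: "s = f a + f b" "t = f c + f e"
      by (elim imageE SigmaE) simp
    have mem: "(\<lambda>i. (a i - c i) - (e i - b i)) \<in> ?D" using v by (intro difference_setI)
    have val: "f (\<lambda>i. (a i - c i) - (e i - b i)) = s - t"
      by (simp add: f st)
    show "s - t \<in> f ` ?D" by (rule image_eqI[of _ f, OF val[symmetric] mem])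
  qed
  moreover have "finite ?D" by (simp add: finite_difference_set simplex_def)
  ultimately show ?thesis by (rule surj_card_le[rotated])
qed

text \<open>\<open>?S\<close> lists all sums of two elements of 0, 1, 5; the next two lemmas add 25
  and then 125. Base 5 loses nothing, since the vectors counted have entries from -2 to 2, and these
  serve as balanced digits.\<close>

lemma card_diffs_roots_2: "19 \<le> card (difference_set (difference_set (simplex 2)))"
proof -
  let ?S = "set [0, 1, 2, 5, 6, 10 :: int]"
  have "19 \<le> card ((\<lambda>(a, b). a - b) ` (?S \<times> ?S))"
    by code_simp
  also have "\<dots> \<le> card (difference_set (difference_set (simplex 2)))"
    by (rule card_diffs_roots_ge) code_simp
  finally show ?thesis .
qed

lemma card_diffs_roots_3: "55 \<le> card (difference_set (difference_set (simplex 3)))"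
proof -
  let ?S = "set [0, 1, 2, 5, 6, 10, 25, 26, 30, 50 :: int]"
  have "55 \<le> card ((\<lambda>(a, b). a - b) ` (?S \<times> ?S))"
    by code_simp
  also have "\<dots> \<le> card (difference_set (difference_set (simplex 3)))"
    by (rule card_diffs_roots_ge) code_simp
  finally show ?thesis .
qed

lemma card_diffs_roots_4: "131 \<le> card (difference_set (difference_set (simplex 4)))"
proof -
  let ?S = "set [0, 1, 2, 5, 6, 10, 25, 26, 30, 50, 125, 126, 130, 150, 250 :: int]"
  have "131 \<le> card ((\<lambda>(a, b). a - b) ` (?S \<times> ?S))"
    by code_simp
  also have "\<dots> \<le> card (difference_set (difference_set (simplex 4)))"
    by (rule card_diffs_roots_ge) code_simp
  finally show ?thesis .
qed

section \<open>Lower bounds for the Heller constant\<close>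

lemma det_submatrix_eq_coldet:
  assumes A: "A \<in> carrier_mat m n" and J: "J \<subseteq> {..<n}" "card J = m"
  shows "det (submatrix A {..<m} J) = coldet m (\<lambda>j i. A $$ (i, pick J j))"
proof -
  have dims: "card {i. i < dim_row A \<and> i \<in> {..<m}} = m" "card {j. j < dim_col A \<and> j \<in> J} = m"
  proof -
    have "{i. i < dim_row A \<and> i \<in> {..<m}} = {..<m}" "{j. j < dim_col A \<and> j \<in> J} = J"
      using A J by auto
    then show "card {i. i < dim_row A \<and> i \<in> {..<m}} = m" "card {j. j < dim_col A \<and> j \<in> J} = m"
      using J by auto
  qed
  have "pick {..<m} i = i" if "i < m" for i
  proof -
    have "{a \<in> {..<m}. a < i} = {..<i}" using that by auto
    then show ?thesis using pick_card_in_set[of i "{..<m}"] that by simp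
  qed
  then show ?thesis
    unfolding submatrix_def coldet_def dims by (intro arg_cong[of _ _ det] eq_matI) auto
qed

text \<open>With \<open>m\<close> rows, \<open>{..<m}\<close> is the only possible row set, so the
  maximum ranges over column sets alone.\<close>

lemma Delta_minor_eq:
  assumes A: "A \<in> carrier_mat m n"
  shows "Delta_minor m A
    = Max ((\<lambda>J. \<bar>coldet m (\<lambda>j i. A $$ (i, pick J j))\<bar>) ` {J. J \<subseteq> {..<n} \<and> card J = m})"
proof -
  have I: "I \<subseteq> {..<m} \<and> card I = m \<longleftrightarrow> I = {..<m}" for I
    using card_subset_eq[of "{..<m}" I] by auto
  have "{\<bar>det (submatrix A I J)\<bar> | I J.
      I \<subseteq> {..<dim_row A} \<and> J \<subseteq> {..<dim_col A} \<and> card I = m \<and> card J = m}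
    = (\<lambda>J. \<bar>det (submatrix A {..<m} J)\<bar>) ` {J. J \<subseteq> {..<n} \<and> card J = m}"
    (is "?L = ?R")
  proof
    show "?L \<subseteq> ?R"
    proof
      fix x assume "x \<in> ?L"
      then obtain K J where x: "x = \<bar>det (submatrix A K J)\<bar>"
        and KJ: "K \<subseteq> {..<m}" "card K = m" "J \<subseteq> {..<n}" "card J = m" using A by auto
      then have "K = {..<m}" using I by blast
      then show "x \<in> ?R" using x KJ by simp
    qed
    show "?R \<subseteq> ?L"
    proof
      fix x assume "x \<in> ?R"
      then obtain J where "x = \<bar>det (submatrix A {..<m} J)\<bar>" "J \<subseteq> {..<n}" "card J = m" by auto
      moreover have "{..<m} \<subseteq> {..<dim_row A}" "dim_col A = n" "card {..<m} = m" using A by auto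
      ultimately show "x \<in> ?L" by blast
    qed
  qed
  also have "\<dots> = (\<lambda>J. \<bar>coldet m (\<lambda>j i. A $$ (i, pick J j))\<bar>) ` {J. J \<subseteq> {..<n} \<and> card J = m}"
    using det_submatrix_eq_coldet[OF A] by (intro image_cong) auto
  finally show ?thesis unfolding Delta_minor_def by simp
qed

text \<open>Submatrices list their columns in increasing order, whereas \<open>c\<close> is an
  arbitrary choice. A repeated column gives 0; otherwise sorting is a permutation and keeps the
  absolute value.\<close>

lemma coldet_le_Delta_minor:
  assumes A: "A \<in> carrier_mat m n" and mn: "m \<le> n" and c: "\<And>j. j < m \<Longrightarrow> c j < n"
  shows "\<bar>coldet m (\<lambda>j i. A $$ (i, c j))\<bar> \<le> Delta_minor m A"
proof -
  let ?M = "\<lambda>J. \<bar>coldet m (\<lambda>j i. A $$ (i, pick J j))\<bar>"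
  have le: "?M J \<le> Delta_minor m A" if "J \<subseteq> {..<n}" "card J = m" for J
    unfolding Delta_minor_eq[OF A] using that by (intro Max_ge) auto
  show ?thesis
  proof (cases "inj_on c {..<m}")
    case False
    then obtain a b where ab: "a < m" "b < m" "a \<noteq> b" "c a = c b"
      unfolding inj_on_def by auto
    have "coldet m (\<lambda>j i. A $$ (i, c j)) = 0"
      by (rule coldet_repeated_column[OF ab(1-3)]) (simp add: ab(4))
    then show ?thesis using le[of "{..<m}"] mn by simp
  next
    case True
    define J where "J = c ` {..<m}"
    have J: "J \<subseteq> {..<n}" "card J = m"
      using c True unfolding J_def by (auto simp: card_image)
    \<comment> \<open>The rank within \<open>J\<close>, inverse to the increasing enumeration
      \<open>pick J\<close>.\<close>
    define r where "r = (\<lambda>x. card {a \<in> J. a < x})"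
    have fJ: "finite J" unfolding J_def by simp
    have r: "pick J (r x) = x" "r x < m" if "x \<in> J" for x
    proof -
      show "pick J (r x) = x" unfolding r_def by (rule pick_card_in_set[OF that])
      have "r x < card J" unfolding r_def by (rule psubset_card_mono) (use that fJ in auto)
      then show "r x < m" using J by simp
    qed
    \<comment> \<open>Beyond \<open>m\<close> the map is the identity, as \<open>permutes\<close>
      demands.\<close>
    define p where "p = (\<lambda>j. if j < m then r (c j) else j)"
    have cJ: "c j \<in> J" if "j < m" for j using that unfolding J_def by simp
    have "inj_on p {0..<m}"
    proof (rule inj_onI)
      fix x y assume xy: "x \<in> {0..<m}" "y \<in> {0..<m}" "p x = p y"
      then have "c x = c y" using r(1)[OF cJ] unfolding p_def by (metis atLeastLessThan_iff)
      then show "x = y" using True xy by (auto dest: inj_onD)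
    qed
    moreover have "p ` {0..<m} \<subseteq> {0..<m}" using r(2)[OF cJ] unfolding p_def by auto
    ultimately have "bij_betw p {0..<m} {0..<m}"
      by (simp add: bij_betw_def endo_inj_surj)
    then have p: "p permutes {0..<m}" by (rule bij_imp_permutes) (simp add: p_def)
    have "coldet m (\<lambda>j i. A $$ (i, c j)) = coldet m (\<lambda>j i. A $$ (i, pick J (p j)))"
      by (rule coldet_cong) (simp add: p_def r(1)[OF cJ])
    then show ?thesis using coldet_permute[OF p, of "\<lambda>j i. A $$ (i, pick J j)"] le[OF J] by simp
  qed
qed

text \<open>By Cramer's rule every column is determined by its coordinates with respect to a maximal
  minor, scaled by that minor; these are themselves minors, hence bounded.\<close>
lemma card_columns_le:
  assumes A: "A \<in> carrier_mat m n" and dist: "distinct (cols A)"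
    and D: "Delta_minor m A = int D" "D > 0" and mn: "m \<le> n"
  shows "n \<le> (2 * D + 1) ^ m"
proof -
  let ?S = "{J. J \<subseteq> {..<n} \<and> card J = m}"
  have "{..<m} \<in> ?S" using mn by simp
  then have "Delta_minor m A \<in> (\<lambda>J. \<bar>coldet m (\<lambda>j i. A $$ (i, pick J j))\<bar>) ` ?S"
    unfolding Delta_minor_eq[OF A] by (intro Max_in) (simp, blast)
  then obtain J where J: "J \<subseteq> {..<n}" "card J = m"
    and max: "\<bar>coldet m (\<lambda>j i. A $$ (i, pick J j))\<bar> = int D" using D by auto
  define c where "c = (\<lambda>j i. A $$ (i, pick J j))"
  define a where "a = (\<lambda>k i. A $$ (i, k))"
  \<comment> \<open>The scaled Cramer coordinates of column \<open>k\<close>; restricting to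
    \<open>{..<m}\<close> places them in a finite function space of cardinality
    \<open>(2 * D + 1) ^ m\<close>.\<close>
  define g where "g = (\<lambda>k. \<lambda>i\<in>{..<m}. coldet m (c(i := a k)))"
  have c0: "coldet m c \<noteq> 0" using max D unfolding c_def by auto
  have pick: "pick J j < n" if "j < m" for j
    using pick_in_set_le[of j J] J that by auto
  have "g k \<in> PiE {..<m} (\<lambda>_. {-int D..int D})" if k: "k < n" for k
  proof -
    have "\<bar>coldet m (c(i := a k))\<bar> \<le> int D" if "i < m" for i
    proof -
      have "c(i := a k) = (\<lambda>j l. A $$ (l, if j = i then k else pick J j))"
        unfolding c_def a_def by auto
      then show ?thesis
        using coldet_le_Delta_minor[OF A mn, of "\<lambda>j. if j = i then k else pick J j"] pick k D
        by auto
    qed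
    then show ?thesis unfolding g_def by (auto simp: abs_le_iff) (metis minus_le_iff)
  qed
  then have "g ` {..<n} \<subseteq> PiE {..<m} (\<lambda>_. {-int D..int D})" by blast
  moreover have "inj_on g {..<n}"
  proof (rule inj_onI)
    fix k l assume kl: "k \<in> {..<n}" "l \<in> {..<n}" "g k = g l"
    have "a k i = a l i" if i: "i < m" for i
    proof -
      have "coldet m (c(j := a k)) = coldet m (c(j := a l))" if "j < m" for j
        using fun_cong[OF kl(3), of j] that unfolding g_def by simp
      then have "coldet m c * a k i = coldet m c * a l i"
        unfolding coldet_cramer[OF i, symmetric] by simp
      then show ?thesis using c0 by simp
    qed
    then have "col A k = col A l" using A kl unfolding a_def by (intro eq_vecI) auto
    then show "k = l" using dist A kl by (auto simp: distinct_conv_nth)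
  qed
  ultimately have "card {..<n} \<le> card (PiE {..<m} (\<lambda>_. {-int D..int D}))"
    by (intro card_inj_on_le[of g]) (auto intro!: finite_PiE)
  also have "\<dots> = card {-int D..int D} ^ m"
    by (simp add: card_PiE)
  also have "card {-int D..int D} = 2 * D + 1"
    by simp
  finally show ?thesis by simp
qed

section \<open>From a set of vectors to a bound on the Heller constant\<close>

text \<open>\<open>Max\<close> is informative only on a finite set. Widths of at least
  \<open>m\<close> are bounded by \<open>card_columns_le\<close>, smaller ones by \<open>m\<close>
  itself.\<close>

lemma le_heller:
  assumes "n > 0" "D > 0" "A \<in> carrier_mat m n" "distinct (cols A)" "Delta_minor m A = int D"
  shows "n \<le> heller D m"
proof -
  let ?H = "{n. n > 0 \<and> (\<exists>A \<in> carrier_mat m n. distinct (cols A) \<and> Delta_minor m A = int D)}"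
  have "?H \<subseteq> {..max m ((2 * D + 1) ^ m)}"
  proof
    fix l assume "l \<in> ?H"
    then obtain B where "B \<in> carrier_mat m l" "distinct (cols B)" "Delta_minor m B = int D" by blast
    then have "l \<le> (2 * D + 1) ^ m" if "m \<le> l" using card_columns_le assms(2) that by blast
    then show "l \<in> {..max m ((2 * D + 1) ^ m)}" by (cases "m \<le> l") auto
  qed
  then have "finite ?H" by (rule finite_subset) simp
  then show ?thesis unfolding heller_def using assms by (intro Max_ge) auto
qed

text \<open>The elements of \<open>V\<close> become the columns. Vanishing from coordinate
  \<open>m\<close> on makes truncation by \<open>vec m\<close> injective, so the columns are
  distinct; \<open>bd\<close> and \<open>cD\<close> bound the largest minor from above and
  below.\<close>

lemma card_le_heller:
  assumes fin: "finite V" and supp: "\<And>x i. x \<in> V \<Longrightarrow> m \<le> i \<Longrightarrow> x i = 0"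
    and bd: "minors_le m V (int D)"
    and c: "\<And>j. j < m \<Longrightarrow> c j \<in> V" and cD: "\<bar>coldet m c\<bar> = int D"
    and pos: "D > 0" "m > 0"
  shows "card V \<le> heller D m"
proof -
  have inj: "inj_on (vec m) V"
  proof (rule inj_onI)
    fix x y assume xy: "x \<in> V" "y \<in> V" "vec m x = vec m y"
    show "x = y"
    proof
      fix i show "x i = y i"
      proof (cases "i < m")
        case True
        then show ?thesis using arg_cong[OF xy(3), of "\<lambda>v. v $ i"] by simp
      next
        case False
        then show ?thesis using supp[OF xy(1), of i] supp[OF xy(2), of i] by simp
      qed
    qed
  qed
  \<comment> \<open>A repeated column would make the determinant 0, but \<open>D\<close> is
    positive.\<close>
  have cinj: "inj_on c {..<m}"
    using coldet_repeated_column[of _ m _ c] cD pos by (force simp: inj_on_def)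
  obtain xs where xs: "set xs = V - c ` {..<m}" "distinct xs"
    using finite_distinct_list[of "V - c ` {..<m}"] fin by auto
  \<comment> \<open>Listing the columns of \<open>c\<close> first makes the extremal minor the one
    on the first \<open>m\<close> columns.\<close>
  define fs where "fs = map c [0..<m] @ xs"
  have fs: "set fs = V" "distinct fs"
    unfolding fs_def using xs c cinj by (auto simp: distinct_map atLeast0LessThan)
  have len: "length fs = card V" using distinct_card[OF fs(2)] fs(1) by simp
  define A where "A = mat_of_cols m (map (vec m) fs)"
  have A: "A \<in> carrier_mat m (card V)" unfolding A_def using len by (metis length_map mat_of_cols_carrier(1))
  have idx: "A $$ (i, j) = (fs ! j) i" if "i < m" "j < card V" for i j
    unfolding A_def using that len by (simp add: mat_of_cols_index)
  have "distinct (map (vec m) fs)" using fs inj by (simp add: distinct_map)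
  moreover have "cols A = map (vec m) fs"
    unfolding A_def by (rule cols_mat_of_cols) auto
  ultimately have dist: "distinct (cols A)" by simp
  have mV: "m \<le> card V" using len unfolding fs_def by simp
  have le: "\<bar>coldet m (\<lambda>j i. A $$ (i, pick J j))\<bar> \<le> int D"
    if J: "J \<subseteq> {..<card V}" "card J = m" for J
  proof -
    have lt: "pick J j < card V" if "j < m" for j
      using pick_in_set_le[of j J] J that by auto
    have "coldet m (\<lambda>j i. A $$ (i, pick J j)) = coldet m (\<lambda>j. fs ! pick J j)"
      by (rule coldet_cong) (simp add: idx lt)
    moreover have "fs ! pick J j \<in> V" if "j < m" for j
      using lt[OF that] len fs(1) nth_mem by metis
    ultimately show ?thesis using bd unfolding minors_le_def by auto
  qed
  have "coldet m c = coldet m (\<lambda>j i. A $$ (i, j))"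
    using mV by (intro coldet_cong) (simp add: idx fs_def nth_append)
  then have "int D \<le> Delta_minor m A"
    using coldet_le_Delta_minor[OF A mV, of "\<lambda>j. j"] mV cD by simp
  moreover have "Delta_minor m A \<le> int D"
  proof -
    have "{..<m} \<in> {J. J \<subseteq> {..<card V} \<and> card J = m}" using mV by simp
    then show ?thesis
      unfolding Delta_minor_eq[OF A] using le by (intro Max.boundedI) (simp, blast, auto)
  qed
  ultimately show ?thesis
    using mV pos by (intro le_heller[OF _ _ A dist]) auto
qed

lemma heller_power_two_ge:
  assumes "d > 0"
  shows "card (difference_set (difference_set (simplex d))) + 2 * k * (d * d + d + 1) + k * k
    \<le> heller (2 ^ d) (d + k) + k"
proof -
  let ?P = "difference_set (simplex d)"
  let ?Q = "?P \<union> unitf ` {d..<d + k}"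
  have fin: "finite ?P" by (simp add: finite_difference_set simplex_def)
  have o: "(\<lambda>i. 0) \<in> simplex d" by (simp add: simplex_def)
  then have zero: "(\<lambda>i. 0) \<in> ?P" using difference_setI[OF o o] by simp
  have van: "q i = 0" if "q \<in> ?P" "d \<le> i" for q i
    by (rule difference_set_vanish[OF that(1)]) (use that(2) in \<open>auto simp: simplex_def unitf_def\<close>)
  \<comment> \<open>A diagonal matrix of determinant \<open>2 ^ d\<close>. The doubled unit vectors
    are differences of the opposite roots \<open>unitf j\<close> and its negative.\<close>
  define c where "c = (\<lambda>j i. (if j < d then 2 else 1) * unitf j i)"
  have "card (difference_set ?Q) \<le> heller (2 ^ d) (d + k)"
  proof (rule card_le_heller)
    show "finite (difference_set ?Q)" using fin by (simp add: finite_difference_set)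
    show "x i = 0" if "x \<in> difference_set ?Q" "d + k \<le> i" for x i
    proof -
      have "q i = 0" if "q \<in> ?Q" for q using that \<open>d + k \<le> i\<close> van by (auto simp: unitf_def)
      then show ?thesis by (rule difference_set_vanish[OF that(1)])
    qed
    show "minors_le (d + k) (difference_set ?Q) (int (2 ^ d))"
      using minors_le_add_units[OF minors_le_diffs[OF minors_le_roots], of d k] zero van by auto
    show "c j \<in> difference_set ?Q" if "j < d + k" for j
    proof (cases "j < d")
      case True
      then have j: "unitf j \<in> simplex d" by (simp add: simplex_def)
      have "(\<lambda>i. (unitf j i - 0) - (0 - unitf j i)) \<in> difference_set ?Q"
        using difference_setI[OF j o] difference_setI[OF o j] by (intro difference_setI) auto
      then show ?thesis using True unfolding c_def by simp
    next
      case False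
      then have "(\<lambda>i. unitf j i - 0) \<in> difference_set ?Q"
        using that zero by (intro difference_setI) auto
      then show ?thesis using False unfolding c_def by simp
    qed
    have "coldet (d + k) c = (\<Prod>j<d + k. if j < d then 2 else 1)"
      by (subst coldet_diagonal) (auto simp: c_def unitf_def)
    also have "\<dots> = (\<Prod>j\<in>{..<d}. 2)"
      by (rule prod.mono_neutral_cong_right) auto
    finally show "\<bar>coldet (d + k) c\<bar> = int (2 ^ d)" by simp
  qed (use assms in auto)
  moreover have "card (difference_set ?Q) + k
      = card (difference_set ?P) + 2 * k * card ?P + k * k"
    by (rule card_diffs_add_units) (use fin zero van in auto)
  ultimately show ?thesis unfolding card_diffs_simplex by linarith
qed

theorem theorem1p3:
  shows "(\<forall>m::nat. m \<ge> 3 \<longrightarrow> int (heller 4 m) \<ge> int m ^ 2 + 9 * int m - 3)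
       \<and> (\<forall>m::nat. m \<ge> 4 \<longrightarrow> int (heller 8 m) \<ge> int m ^ 2 + 19 * int m - 11)
       \<and> (\<forall>m::nat. m \<ge> 10 \<longrightarrow> int (heller 16 m) \<ge> int m ^ 2 + 33 * int m - 17)"
proof (intro conjI allI impI)
  fix m :: nat
  assume "m \<ge> 3"
  then have "m = 2 + (m - 2)" by simp
  then obtain k where m: "m = 2 + k" by blast
  \<comment> \<open>Here 7 is \<open>d * d + d + 1\<close> for \<open>d = 2\<close>; likewise 13 and
    21 below for \<open>d = 3\<close> and \<open>d = 4\<close>. Substituting
    \<open>k = m - d\<close> gives exactly the stated quadratics.\<close>
  have "19 + 2 * k * 7 + k * k \<le> heller 4 m + k"
    using heller_power_two_ge[of 2 k] card_diffs_roots_2 unfolding m by simp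
  then have "int (19 + 2 * k * 7 + k * k) \<le> int (heller 4 m + k)" by (simp only: of_nat_le_iff)
  then show "int (heller 4 m) \<ge> int m ^ 2 + 9 * int m - 3"
    unfolding m by (simp add: power2_eq_square algebra_simps)
next
  fix m :: nat
  assume "m \<ge> 4"
  then have "m = 3 + (m - 3)" by simp
  then obtain k where m: "m = 3 + k" by blast
  have "55 + 2 * k * 13 + k * k \<le> heller 8 m + k"
    using heller_power_two_ge[of 3 k] card_diffs_roots_3 unfolding m by simp
  then have "int (55 + 2 * k * 13 + k * k) \<le> int (heller 8 m + k)" by (simp only: of_nat_le_iff)
  then show "int (heller 8 m) \<ge> int m ^ 2 + 19 * int m - 11"
    unfolding m by (simp add: power2_eq_square algebra_simps)
next
  fix m :: nat
  assume "m \<ge> 10"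
  then have "m = 4 + (m - 4)" by simp
  then obtain k where m: "m = 4 + k" by blast
  have "131 + 2 * k * 21 + k * k \<le> heller 16 m + k"
    using heller_power_two_ge[of 4 k] card_diffs_roots_4 unfolding m by simp
  then have "int (131 + 2 * k * 21 + k * k) \<le> int (heller 16 m + k)" by (simp only: of_nat_le_iff)
  then show "int (heller 16 m) \<ge> int m ^ 2 + 33 * int m - 17"
    unfolding m by (simp add: power2_eq_square algebra_simps)
qed

end
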